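(* For every prime $p$ and every natural number $c \geq 1$, $$\binom{2p^c-1}{p^c}\equiv 1 \pmod p.$$
   Context: Natural numbers are positive integers here; $\binom{n}{x}$ denotes the usual binomial coefficient. *)

theory Defs
  imports "HOL-Number_Theory.Number_Theory"
begin

end

theory Submission
  imports Defs
begin

text \<open>By Vandermonde, \<open>(2q-1 choose q) = (\<Sum>k\<le>q. (q choose k) (q-1 choose q-k))\<close> for \<open>q = p^c\<close>.
  The prime \<open>p\<close> divides every term with \<open>0 < k < q\<close>, the term \<open>k = 0\<close> vanishes, and
  the term \<open>k = q\<close> is 1.\<close>

text \<open>By absorption, \<open>p ^ c\<close> divides \<open>k * (p ^ c choose k)\<close>. Were
  the binomial prime to \<open>p\<close>, all of \<open>p ^ c\<close> would have to divide
  \<open>k\<close>, which is positive and too small.\<close>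

lemma prime_dvd_prime_power_choose:
  fixes p c k :: nat
  assumes "prime p" "0 < k" "k < p ^ c"
  shows "p dvd (p ^ c choose k)"
proof (rule ccontr)
  assume "\<not> p dvd (p ^ c choose k)"
  with \<open>prime p\<close> have "coprime (p ^ c) (p ^ c choose k)"
    by (simp add: prime_imp_coprime)
  moreover have "p ^ c dvd k * (p ^ c choose k)"
    using \<open>0 < k\<close> by (simp add: times_binomial_minus1_eq)
  ultimately have "p ^ c dvd k"
    by (simp add: coprime_dvd_mult_left_iff)
  with \<open>0 < k\<close> \<open>k < p ^ c\<close> show False
    by (simp add: nat_dvd_not_less)
qed

theorem theorem2p10:
  fixes p c :: nat
  assumes "prime p" and "c \<ge> 1"
  shows "[(2 * p ^ c - 1) choose (p ^ c) = 1] (mod p)"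
proof -
  define q where "q = p ^ c"
  have "q > 0"
    using \<open>prime p\<close> by (simp add: q_def prime_gt_0_nat)
  let ?f = "\<lambda>k. (q choose k) * ((q - 1) choose (q - k))"
  \<comment> \<open>Splits \<open>2 * q - 1\<close> as \<open>q + (q - 1)\<close>; the truncated
    subtraction is why \<open>q > 0\<close> is supplied.\<close>
  have "(2 * q - 1) choose q = (\<Sum>k\<le>q. ?f k)"
    using \<open>q > 0\<close> by (simp add: vandermonde mult_2)
  also have "\<dots> = (\<Sum>k<q. ?f k) + 1"
    by (simp flip: lessThan_Suc_atMost)
  finally have expand: "(2 * q - 1) choose q = (\<Sum>k<q. ?f k) + 1" .
  have "p dvd ?f k" if "k < q" for k
  proof (cases "k = 0")
    case True
    \<comment> \<open>The first factor is 1 here, so divisibility comes from the second,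
      \<open>(q - 1) choose q\<close>, which is 0.\<close>
    with \<open>q > 0\<close> show ?thesis by (simp add: binomial_eq_0)
  next
    case False
    with that prime_dvd_prime_power_choose[OF \<open>prime p\<close>] show ?thesis
      by (simp add: q_def)
  qed
  then have "p dvd (\<Sum>k<q. ?f k)"
    by (intro dvd_sum) simp
  then have "[(\<Sum>k<q. ?f k) + 1 = 0 + 1] (mod p)"
    by (intro cong_add) (simp_all add: cong_0_iff)
  with expand show ?thesis
    by (simp add: q_def)
qed

end
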